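(* Let $d\ge 2$ be an integer and let $y \in \nabla^{d-1}$ satisfying $y_1 > y_2 > \dots > y_d$ be given. Define $a \in \mathbb{R}^d$ via $$a_k = \begin{cases} -1 - \dfrac{y_{2}}{y_{1} - y_2}, & k=1, \\[2mm] \dfrac{y_{k}}{y_{k-1} - y_k} - \dfrac{y_{k+1}}{y_{k} - y_{k+1}}, & k=2,\dots,d-1, \\[2mm] \dfrac{y_d}{y_{d-1} - y_d}, & k = d. \end{cases}$$ Then $\bar a_k > 0$ for $k=2,\dots,d$, $\bar a_1 = -1$, and $\mathbb{E}_a[Y_k] = y_k$ for $k=1,\dots,d$.
   Context: For a vector $v \in \mathbb{R}^d$, write $\bar v_k := v_k + v_{k+1} + \dots + v_d$ for its tail sums, $k=1,\dots,d$. The ordered simplex is $\nabla^{d-1} = \{y \in \mathbb{R}^d: y_1 \geq y_2\geq \dots \geq y_d \geq 0,\ y_1+\dots+y_d = 1\}$. Integrals $dy$ over $\nabla^{d-1}$ are with respect to the pushforward of Lebesgue measure on $\mathbb{R}^{d-1}$ under $(y_1,\dots,y_{d-1}) \mapsto (y_1,\dots,y_{d-1},1-y_1-\dots-y_{d-1})$. For $a \in \mathbb{R}^d$ with $\bar a_k>0$ for $k=2,\dots,d$, the constant $Q_a = \int_{\nabla^{d-1}}\prod_{k=1}^d y_k^{a_k-1}\,dy$ is finite (known fact), and the Generalized Rank Dirichlet distribution GRD$(a)$ is the probability measure $\mathbb{P}_a(A) = Q_a^{-1}\int_{\nabla^{d-1}} \prod_{k=1}^d y_k^{a_k-1} 1_A(y)\,dy$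 on Borel subsets $A$ of $\nabla^{d-1}$. $\mathbb{E}_a$ denotes expectation under $\mathbb{P}_a$, and $Y=(Y_1,\dots,Y_d)$ is a random vector with law $\mathbb{P}_a$ under $\mathbb{P}_a$ (e.g. the identity map on $\nabla^{d-1}$).
   Formalization: The formal statement additionally assumes y_d > 0; if y_d = 0 (e.g. d = 2, y = (1,0), a = (-1,0)) then a_d = 0, so the claimed tail-sum positivity at k = d fails and GRD(a) is undefined. *)

theory Defs
  imports "HOL-Probability.Probability"
begin

text \<open>
  Since the dimension \<open>d\<close> is a variable, a vector in \<open>\<real>\<^sup>d\<close> is a function \<open>nat \<Rightarrow> real\<close> indexed by
  \<open>{1..d}\<close>. Points of measure spaces are extensional, i.e. lie in \<open>{1..d} \<rightarrow>\<^sub>E UNIV\<close>, and the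
  Borel sets of \<open>\<real>\<^sup>d\<close> are those of the product sigma-algebra \<open>Pi\<^sub>M {1..d} (\<lambda>_. borel)\<close>.
\<close>

definition tail_sum :: "nat \<Rightarrow> (nat \<Rightarrow> real) \<Rightarrow> nat \<Rightarrow> real" where
  "tail_sum d v k = (\<Sum>i=k..d. v i)"

definition ordered_simplex :: "nat \<Rightarrow> (nat \<Rightarrow> real) set" where
  "ordered_simplex d =
     {y \<in> {1..d} \<rightarrow>\<^sub>E UNIV. (\<forall>k\<in>{1..<d}. y k \<ge> y (Suc k)) \<and> y d \<ge> 0 \<and> (\<Sum>k=1..d. y k) = 1}"

definition simplex_embed :: "nat \<Rightarrow> (nat \<Rightarrow> real) \<Rightarrow> (nat \<Rightarrow> real)" where
  "simplex_embed d x = x(d := 1 - (\<Sum>i=1..<d. x i))"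

definition simplex_measure :: "nat \<Rightarrow> (nat \<Rightarrow> real) measure" where
  "simplex_measure d =
     restrict_space
       (distr (Pi\<^sub>M {1..<d} (\<lambda>_. lborel)) (Pi\<^sub>M {1..d} (\<lambda>_. borel)) (simplex_embed d))
       (ordered_simplex d)"

text \<open>
  On the null set where some coordinate vanishes, the convention \<open>0 powr s = 0\<close> applies.
\<close>

definition GRD_weight :: "nat \<Rightarrow> (nat \<Rightarrow> real) \<Rightarrow> (nat \<Rightarrow> real) \<Rightarrow> real" where
  "GRD_weight d a y = (\<Prod>k=1..d. y k powr (a k - 1))"

definition GRD_const :: "nat \<Rightarrow> (nat \<Rightarrow> real) \<Rightarrow> ennreal" where
  "GRD_const d a = (\<integral>\<^sup>+ y. ennreal (GRD_weight d a y) \<partial>simplex_measure d)"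

definition GRD :: "nat \<Rightarrow> (nat \<Rightarrow> real) \<Rightarrow> (nat \<Rightarrow> real) measure" where
  "GRD d a = density (simplex_measure d) (\<lambda>y. ennreal (GRD_weight d a y) / GRD_const d a)"

lemma measurable_simplex_embed:
  assumes "d \<ge> 1"
  shows "simplex_embed d \<in> measurable (Pi\<^sub>M {1..<d} (\<lambda>_. lborel)) (Pi\<^sub>M {1..d} (\<lambda>_. borel))"
proof -
  have d: "{1..d} = insert d {1..<d}"
    using assms by auto
  have "(\<lambda>x. x(d := 1 - (\<Sum>i=1..<d. x i)))
          \<in> measurable (Pi\<^sub>M {1..<d} (\<lambda>_. lborel)) (Pi\<^sub>M (insert d {1..<d}) (\<lambda>_. borel :: real measure))"
    by (rule measurable_fun_upd[where J = "{1..<d}"])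
       (auto intro!: borel_measurable_diff borel_measurable_sum measurable_ident_sets
         sets_PiM_cong measurable_component_singleton[where M = "\<lambda>_. lborel", simplified])
  then show ?thesis
    unfolding d simplex_embed_def by simp
qed

lemma sets_ordered_simplex:
  assumes "d \<ge> 1"
  shows "ordered_simplex d \<in> sets (Pi\<^sub>M {1..d} (\<lambda>_. borel))"
proof -
  let ?M = "Pi\<^sub>M {1..d} (\<lambda>_. borel :: real measure)"
  have c: "(\<lambda>y. y k) \<in> borel_measurable ?M" if "k \<in> {1..d}" for k
    using that by (rule measurable_component_singleton)
  have eq: "ordered_simplex d = {y \<in> space ?M. (\<forall>k\<in>{1..<d}. y (Suc k) \<le> y k) \<and> 0 \<le> y d
      \<and> (\<Sum>k=1..d. y k) = 1}"
    by (auto simp: ordered_simplex_def space_PiM)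
  show ?thesis
    unfolding eq using assms
    by (intro sets.sets_Collect sets.sets_Collect_finite_All borel_measurable_le
        measurable_equality_set borel_measurable_sum borel_measurable_const c) auto
qed

lemma emeasure_GRD:
  assumes "d \<ge> 1" and "A \<in> sets (Pi\<^sub>M {1..d} (\<lambda>_. borel))" and "A \<subseteq> ordered_simplex d"
  shows "emeasure (GRD d a) A =
    (\<integral>\<^sup>+ y. ennreal (GRD_weight d a y) * indicator A y \<partial>simplex_measure d) / GRD_const d a"
proof -
  let ?M = "Pi\<^sub>M {1..d} (\<lambda>_. borel :: real measure)"
  have A: "A \<in> sets (simplex_measure d)"
    using assms sets_ordered_simplex[OF assms(1)]
    by (simp add: simplex_measure_def sets_restrict_space_iff space_PiM)
  have w: "GRD_weight d a \<in> borel_measurable ?M"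
    unfolding GRD_weight_def
    by (intro borel_measurable_prod powr_real_measurable borel_measurable_const
        measurable_component_singleton)
  have w': "GRD_weight d a \<in> borel_measurable (simplex_measure d)"
    unfolding simplex_measure_def by (rule measurable_restrict_space1) (use w in simp)
  have "emeasure (GRD d a) A =
      (\<integral>\<^sup>+ y. ennreal (GRD_weight d a y) * indicator A y / GRD_const d a \<partial>simplex_measure d)"
    unfolding GRD_def using A w'
    by (auto simp: emeasure_density divide_ennreal_def mult_ac intro!: nn_integral_cong)
  also have "\<dots> = (\<integral>\<^sup>+ y. ennreal (GRD_weight d a y) * indicator A y \<partial>simplex_measure d) / GRD_const d a"
    using A w' by (intro nn_integral_divide borel_measurable_times_ennreal borel_measurable_indicator) auto
  finally show ?thesis .
qed

end

theory Submission
  imports Defs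
begin

text \<open>
  Since \<open>a\<close> has total sum \<open>-1\<close>, the density times a coordinate is homogeneous of degree \<open>-d\<close>, so its
  integral over the simplex equals its integral over the slice \<open>y\<^sub>1 = 1\<close> of the cone
  \<open>y\<^sub>1 \<ge> \<dots> \<ge> y\<^sub>d \<ge> 0\<close>. There the weight is a product of powers and one integrates out
  \<open>y\<^sub>d, y\<^sub>d\<^sub>-\<^sub>1, \<dots>\<close> successively. Writing \<open>t\<^sub>j\<close> for the tail sums of \<open>a\<close>, the unnormalized mean of \<open>Y\<^sub>k\<close> is
  \<open>\<Prod>\<^sub>j\<^sub>\<le>\<^sub>k 1 / (t\<^sub>j + 1) \<cdot> \<Prod>\<^sub>j\<^sub>>\<^sub>k 1 / t\<^sub>j\<close>, where \<open>j\<close> starts at \<open>2\<close>. As \<open>t\<^sub>j / (t\<^sub>j + 1) = y\<^sub>j / y\<^sub>j\<^sub>-\<^sub>1\<close>, these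
  numbers are proportional to \<open>y\<^sub>k\<close>, and both \<open>Y\<close> and \<open>y\<close> have coordinate sum \<open>1\<close>.
\<close>

section \<open>Scaling of Lebesgue measure on finite products\<close>

abbreviation lborel_PiM :: "'i set \<Rightarrow> ('i \<Rightarrow> real) measure" where
  "lborel_PiM I \<equiv> Pi\<^sub>M I (\<lambda>_. lborel)"

interpretation lborel_PiM: product_sigma_finite "\<lambda>_::'i. lborel :: real measure"
  by standard

text \<open>The pushforward defining \<open>simplex_measure\<close> lives on \<open>borel\<close>
  factors while its source has \<open>lborel\<close> factors; this equality carries measurability
  from one description to the other.\<close>

lemma sets_lborel_PiM: "sets (lborel_PiM I) = sets (Pi\<^sub>M I (\<lambda>_. borel))"
  by (intro sets_PiM_cong) auto

lemma measurable_lborel_PiM_component [measurable]: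
  "i \<in> I \<Longrightarrow> (\<lambda>x. x i) \<in> borel_measurable (lborel_PiM I)"
  using measurable_component_singleton[of i I "\<lambda>_. lborel :: real measure"] by simp

lemma sigma_finite_lborel_PiM: "finite I \<Longrightarrow> sigma_finite_measure (lborel_PiM I)"
  by (rule lborel_PiM.sigma_finite)

lemma measurable_restrict_scale:
  "(\<lambda>x. \<lambda>i\<in>I. c * x i) \<in> measurable (lborel_PiM I) (lborel_PiM I)"
  by (rule measurable_restrict) simp

text \<open>Each coordinate contributes one Jacobian factor \<open>c\<close>. The induction splits
  off coordinate \<open>i\<close>, applies the hypothesis to the inner integral as a function of the
  remaining coordinates, and then substitutes \<open>c * t\<close> for \<open>t\<close> in the inner
  integral. The scaled point is written as a restriction so that it stays extensional.\<close>

lemma nn_integral_lborel_PiM_scale: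
  assumes "finite I" "c > 0" and f: "f \<in> borel_measurable (lborel_PiM I)"
  shows "(\<integral>\<^sup>+x. f x \<partial>lborel_PiM I) =
    ennreal (c ^ card I) * (\<integral>\<^sup>+x. f (\<lambda>i\<in>I. c * x i) \<partial>lborel_PiM I)"
  using assms(1) f
proof (induction I arbitrary: f rule: finite_induct)
  case empty
  then show ?case by (simp add: PiM_empty nn_integral_count_space_finite restrict_def)
next
  case (insert i I)
  note f = insert.prems
  have f1: "(\<lambda>x. f (\<lambda>j\<in>insert i I. c * x j)) \<in> borel_measurable (lborel_PiM (insert i I))"
    by (rule measurable_compose[OF measurable_restrict_scale f])
  have f2: "(\<lambda>x. f (x(i := t))) \<in> borel_measurable (lborel_PiM I)" for t
    by (rule measurable_compose[OF _ f], rule measurable_fun_upd[where J = I]) auto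
  have f3: "(\<lambda>t. f (x(i := t))) \<in> borel_measurable borel" if "x \<in> space (lborel_PiM I)" for x
    by (rule measurable_compose[OF _ f], rule measurable_fun_upd[where J = I]) (use that in auto)
  have f4: "(\<lambda>x. \<integral>\<^sup>+t. f (x(i := t)) \<partial>lborel) \<in> borel_measurable (lborel_PiM I)"
    using measurable_compose[OF measurable_add_dim f]
    by (intro sigma_finite_measure.borel_measurable_nn_integral sigma_finite_lborel)
       (simp add: split_beta' del: fun_upd_apply)
  have f5: "(\<lambda>x. \<integral>\<^sup>+t. f (\<lambda>j\<in>insert i I. c * (x(i := t)) j) \<partial>lborel) \<in> borel_measurable (lborel_PiM I)"
    using measurable_compose[OF measurable_add_dim f1]
    by (intro sigma_finite_measure.borel_measurable_nn_integral sigma_finite_lborel)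
       (simp add: split_beta' del: fun_upd_apply)
  have upd: "(\<lambda>j\<in>I. c * x j)(i := c * t) = (\<lambda>j\<in>insert i I. c * (x(i := t)) j)" for x t
    using insert.hyps by (auto simp: fun_eq_iff)
  have "(\<integral>\<^sup>+x. f x \<partial>lborel_PiM (insert i I)) = (\<integral>\<^sup>+x. \<integral>\<^sup>+t. f (x(i := t)) \<partial>lborel \<partial>lborel_PiM I)"
    by (rule lborel_PiM.product_nn_integral_insert) (use insert in auto)
  also have "\<dots> = ennreal (c ^ card I) *
      (\<integral>\<^sup>+x. \<integral>\<^sup>+t. f ((\<lambda>j\<in>I. c * x j)(i := t)) \<partial>lborel \<partial>lborel_PiM I)"
    by (rule insert.IH[OF f4])
  also have "(\<integral>\<^sup>+x. \<integral>\<^sup>+t. f ((\<lambda>j\<in>I. c * x j)(i := t)) \<partial>lborel \<partial>lborel_PiM I) =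
      (\<integral>\<^sup>+x. ennreal c * (\<integral>\<^sup>+t. f (\<lambda>j\<in>insert i I. c * (x(i := t)) j) \<partial>lborel) \<partial>lborel_PiM I)"
  proof (rule nn_integral_cong)
    fix x assume "x \<in> space (lborel_PiM I)"
    then have x: "(\<lambda>j\<in>I. c * x j) \<in> space (lborel_PiM I)"
      by (auto simp: space_PiM)
    show "(\<integral>\<^sup>+t. f ((\<lambda>j\<in>I. c * x j)(i := t)) \<partial>lborel) =
        ennreal c * (\<integral>\<^sup>+t. f (\<lambda>j\<in>insert i I. c * (x(i := t)) j) \<partial>lborel)"
      using nn_integral_real_affine[OF f3[OF x], of c 0] assms(2) by (simp add: upd)
  qed
  also have "\<dots> = ennreal c * (\<integral>\<^sup>+x. f (\<lambda>j\<in>insert i I. c * x j) \<partial>lborel_PiM (insert i I))"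
    using f5 by (subst lborel_PiM.product_nn_integral_insert[OF insert.hyps f1]) (rule nn_integral_cmult)
  finally show ?case
    using insert.hyps assms(2)
    by (simp add: mult.assoc[symmetric] ennreal_mult'[symmetric] mult.commute del: restrict_apply)
qed

section \<open>Moving an integral from the simplex to the slice with first coordinate 1\<close>

text \<open>
  Both sides equal the integral of \<open>g\<close> over the part of \<open>\<real>\<^sup>d\<close> where the coordinates sum to less than
  \<open>1\<close>: slice by the coordinate sum for the left one, by the first coordinate for the right one.
\<close>
lemma nn_integral_simplex_embed_homogeneous:
  fixes g :: "(nat \<Rightarrow> real) \<Rightarrow> ennreal"
  assumes d: "d \<ge> 1" and g: "g \<in> borel_measurable (lborel_PiM {1..d})"
    and hom: "\<And>c y. c > 0 \<Longrightarrow> ennreal (c ^ (d - 1)) * g (\<lambda>i\<in>{1..d}. c * y i) = g y"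
    and supp: "\<And>y. g y \<noteq> 0 \<Longrightarrow> y 1 > 0 \<and> (\<Sum>i=1..d. y i) > 0"
  shows "(\<integral>\<^sup>+x. g (simplex_embed d x) \<partial>lborel_PiM {1..<d}) =
    (\<integral>\<^sup>+z. g (z(1 := 1)) / ennreal (\<Sum>i=1..d. (z(1 := 1)) i) \<partial>lborel_PiM {2..d})"
proof -
  \<comment> \<open>Only an upper bound on the coordinate sum is imposed, since \<open>supp\<close>
    forces the sum to be positive wherever \<open>g\<close> is nonzero.\<close>
  define G where "G = (\<lambda>y. g y * indicator {..<1} (\<Sum>i=1..d. y i))"
  have G: "G \<in> borel_measurable (lborel_PiM {1..d})"
    unfolding G_def using g by measurable
  have split_d: "insert d {1..<d} = {1..d}" and split_1: "insert 1 {2..d} = {1..d}"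
    using d by auto
  have sum_d: "(\<Sum>i=1..d. y i) = (\<Sum>i=1..<d. y i) + y d" for y :: "nat \<Rightarrow> real"
    by (subst split_d[symmetric]) simp
  have sum_1: "(\<Sum>i=1..d. y i) = y 1 + (\<Sum>i=2..d. y i)" for y :: "nat \<Rightarrow> real"
    by (subst split_1[symmetric]) simp
  interpret A: sigma_finite_measure "lborel_PiM {1..<d}" by (rule sigma_finite_lborel_PiM) simp
  interpret B: sigma_finite_measure "lborel_PiM {2..d}" by (rule sigma_finite_lborel_PiM) simp
  interpret PA: pair_sigma_finite "lborel_PiM {1..<d}" "lborel :: real measure" ..
  interpret PB: pair_sigma_finite "lborel_PiM {2..d}" "lborel :: real measure" ..

  have upd_d: "(\<lambda>(x, t). x(d := t)) \<in> measurable (lborel_PiM {1..<d} \<Otimes>\<^sub>M lborel) (lborel_PiM {1..d})"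
    using measurable_add_dim[of d "{1..<d}" "\<lambda>_. lborel :: real measure"] by (simp only: split_d)
  have upd_1: "(\<lambda>(x, t). x(1 := t)) \<in> measurable (lborel_PiM {2..d} \<Otimes>\<^sub>M lborel) (lborel_PiM {1..d})"
    using measurable_add_dim[of 1 "{2..d}" "\<lambda>_. lborel :: real measure"] by (simp only: split_1)
  have Gd: "(\<lambda>t. G (x(d := t))) \<in> borel_measurable borel" if "x \<in> space (lborel_PiM {1..<d})" for x
    using measurable_compose[OF measurable_compose[OF measurable_Pair1'[OF that] upd_d] G] by simp
  have "(\<lambda>p. ((fst p)::nat \<Rightarrow> real, snd p - (\<Sum>i=1..<d. fst p i)))
      \<in> measurable (lborel_PiM {1..<d} \<Otimes>\<^sub>M lborel) (lborel_PiM {1..<d} \<Otimes>\<^sub>M lborel)"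
    by measurable
  from measurable_compose[OF this measurable_compose[OF upd_d g]]
  have gs: "(\<lambda>(x, s). g (x(d := s - (\<Sum>i=1..<d. x i)))) \<in> borel_measurable (lborel_PiM {1..<d} \<Otimes>\<^sub>M lborel)"
    by (simp add: split_beta')

  have "(\<integral>\<^sup>+y. G y \<partial>lborel_PiM {1..d}) = (\<integral>\<^sup>+x. \<integral>\<^sup>+t. G (x(d := t)) \<partial>lborel \<partial>lborel_PiM {1..<d})"
    using lborel_PiM.product_nn_integral_insert[of "{1..<d}" d G] G by (simp only: split_d) simp
  \<comment> \<open>Shifting the last coordinate by the sum of the others has unit Jacobian and
    turns the variable into the full coordinate sum \<open>s\<close>, so the cutoff depends on
    \<open>s\<close> alone.\<close>
  also have "\<dots> = (\<integral>\<^sup>+x. \<integral>\<^sup>+s. g (x(d := s - (\<Sum>i=1..<d. x i))) * indicator {..<1} s \<partial>lborel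
      \<partial>lborel_PiM {1..<d})"
  proof (rule nn_integral_cong)
    fix x assume x: "x \<in> space (lborel_PiM {1..<d})"
    have Gx: "G (x(d := t)) = g (x(d := t)) * indicator {..<1} ((\<Sum>i=1..<d. x i) + t)" for t
      unfolding G_def sum_d by simp
    show "(\<integral>\<^sup>+t. G (x(d := t)) \<partial>lborel) =
        (\<integral>\<^sup>+s. g (x(d := s - (\<Sum>i=1..<d. x i))) * indicator {..<1} s \<partial>lborel)"
      by (subst nn_integral_real_affine[OF Gd[OF x], of 1 "- (\<Sum>i=1..<d. x i)"])
         (simp_all add: Gx del: fun_upd_apply)
  qed
  also have "\<dots> = (\<integral>\<^sup>+s. \<integral>\<^sup>+x. g (x(d := s - (\<Sum>i=1..<d. x i))) * indicator {..<1} s \<partial>lborel_PiM {1..<d}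
      \<partial>lborel)"
    by (rule PA.Fubini'[symmetric]) (use gs in \<open>simp add: split_beta'\<close>)
  \<comment> \<open>All slices with \<open>s > 0\<close> have the same integral: scaling by
    \<open>s\<close> costs \<open>s ^ (d - 1)\<close>, which \<open>hom\<close> absorbs. Slices with
    \<open>s \<le> 0\<close> vanish by \<open>supp\<close>, so \<open>s\<close> ranges over an
    interval of length one.\<close>
  also have "\<dots> = (\<integral>\<^sup>+s. (\<integral>\<^sup>+x. g (simplex_embed d x) \<partial>lborel_PiM {1..<d}) * indicator {0<..<1::real} s \<partial>lborel)"
  proof (rule nn_integral_cong)
    fix s :: real
    have m: "(\<lambda>x. g (x(d := s - (\<Sum>i=1..<d. x i)))) \<in> borel_measurable (lborel_PiM {1..<d})" for s
      using measurable_compose[OF measurable_Pair2'[of s lborel] gs] by simp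
    show "(\<integral>\<^sup>+x. g (x(d := s - (\<Sum>i=1..<d. x i))) * indicator {..<1} s \<partial>lborel_PiM {1..<d}) =
        (\<integral>\<^sup>+x. g (simplex_embed d x) \<partial>lborel_PiM {1..<d}) * indicator {0<..<1} s"
    proof (cases "s > 0")
      case True
      have eq: "((\<lambda>i\<in>{1..<d}. s * x i)(d := s - (\<Sum>i=1..<d. (\<lambda>i\<in>{1..<d}. s * x i) i))) =
          (\<lambda>i\<in>{1..d}. s * simplex_embed d x i)" for x
        using d by (auto simp: fun_eq_iff simplex_embed_def sum_distrib_left algebra_simps)
      have m': "(\<lambda>x. g (\<lambda>i\<in>{1..d}. s * simplex_embed d x i)) \<in> borel_measurable (lborel_PiM {1..<d})"
        unfolding eq[symmetric] by (rule measurable_compose[OF measurable_restrict_scale m])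
      have "(\<integral>\<^sup>+x. g (x(d := s - (\<Sum>i=1..<d. x i))) \<partial>lborel_PiM {1..<d}) =
          ennreal (s ^ (d - 1)) * (\<integral>\<^sup>+x. g (\<lambda>i\<in>{1..d}. s * simplex_embed d x i) \<partial>lborel_PiM {1..<d})"
        by (subst nn_integral_lborel_PiM_scale[OF finite_atLeastLessThan True m])
           (simp only: eq card_atLeastLessThan)
      also have "\<dots> = (\<integral>\<^sup>+x. g (simplex_embed d x) \<partial>lborel_PiM {1..<d})"
        by (subst nn_integral_cmult[OF m', symmetric]) (simp only: hom[OF True])
      finally show ?thesis
        using True by (auto simp: indicator_def)
    next
      case False
      have "g (x(d := s - (\<Sum>i=1..<d. x i))) = 0" for x
        using supp[of "x(d := s - (\<Sum>i=1..<d. x i))"] False unfolding sum_d by auto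
      with False show ?thesis by simp
    qed
  qed
  also have "\<dots> = (\<integral>\<^sup>+x. g (simplex_embed d x) \<partial>lborel_PiM {1..<d})"
    by (subst nn_integral_cmult_indicator) auto
  finally have left: "(\<integral>\<^sup>+y. G y \<partial>lborel_PiM {1..d}) = (\<integral>\<^sup>+x. g (simplex_embed d x) \<partial>lborel_PiM {1..<d})" .

  \<comment> \<open>\<open>S z\<close> is the coordinate sum of the slice point
    \<open>z(1 := 1)\<close>; its multiple by \<open>t\<close> has coordinate sum
    \<open>t * S z\<close>.\<close>
  define S where "S = (\<lambda>z::nat \<Rightarrow> real. \<Sum>i=1..d. (z(1 := 1)) i)"
  have S_eq: "S = (\<lambda>z. 1 + (\<Sum>i=2..d. z i))"
    unfolding S_def by (subst sum_1) simp
  have G1: "(\<lambda>(z, t). G (z(1 := t))) \<in> borel_measurable (lborel_PiM {2..d} \<Otimes>\<^sub>M lborel)"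
    using measurable_compose[OF upd_1 G] by (simp add: split_beta')
  have g1: "(\<lambda>z. g (z(1 := 1))) \<in> borel_measurable (lborel_PiM {2..d})"
    using measurable_compose[OF measurable_compose[OF measurable_Pair2'[of 1 lborel] upd_1] g] by simp
  have "(\<integral>\<^sup>+y. G y \<partial>lborel_PiM {1..d}) = (\<integral>\<^sup>+t. \<integral>\<^sup>+z. G (z(1 := t)) \<partial>lborel_PiM {2..d} \<partial>lborel)"
    using lborel_PiM.product_nn_integral_insert_rev[of "{2..d}" 1 G] G by (simp only: split_1) simp
  \<comment> \<open>Scaling the remaining coordinates by the first coordinate \<open>t\<close> again
    costs \<open>t ^ (d - 1)\<close>, absorbed by \<open>hom\<close>. This time the cutoff survives
    and couples \<open>t\<close> to \<open>z\<close>.\<close>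
  also have "\<dots> = (\<integral>\<^sup>+t. \<integral>\<^sup>+z. g (z(1 := 1)) * (indicator {0<..} t * indicator {..<1} (t * S z))
      \<partial>lborel_PiM {2..d} \<partial>lborel)"
  proof (rule nn_integral_cong)
    fix t :: real
    have m: "(\<lambda>z. G (z(1 := t))) \<in> borel_measurable (lborel_PiM {2..d})"
      using measurable_compose[OF measurable_Pair2'[of t lborel] G1] by simp
    show "(\<integral>\<^sup>+z. G (z(1 := t)) \<partial>lborel_PiM {2..d}) = 
      (\<integral>\<^sup>+z. g (z(1 := 1)) * (indicator {0<..} t * indicator {..<1} (t * S z)) \<partial>lborel_PiM {2..d})"
    proof (cases "t > 0")
      case True
      have eq: "(\<lambda>i\<in>{2..d}. t * z i)(1 := t) = (\<lambda>i\<in>{1..d}. t * (z(1 := 1)) i)" for z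
        using d by (auto simp: fun_eq_iff)
      have card: "card {2..d} = d - 1"
        by simp
      have sum_eq: "(\<Sum>i=1..d. (\<lambda>i\<in>{1..d}. t * (z(1 := 1)) i) i) = t * S z" for z
        by (simp add: S_def sum_distrib_left)
      have m': "(\<lambda>z. G (\<lambda>i\<in>{1..d}. t * (z(1 := 1)) i)) \<in> borel_measurable (lborel_PiM {2..d})"
        unfolding eq[symmetric] by (rule measurable_compose[OF measurable_restrict_scale m])
      have "(\<integral>\<^sup>+z. G (z(1 := t)) \<partial>lborel_PiM {2..d}) =
          ennreal (t ^ (d - 1)) * (\<integral>\<^sup>+z. G (\<lambda>i\<in>{1..d}. t * (z(1 := 1)) i) \<partial>lborel_PiM {2..d})"
        by (subst nn_integral_lborel_PiM_scale[OF finite_atLeastAtMost True m]) (simp only: eq card)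
      also have "\<dots> = (\<integral>\<^sup>+z. ennreal (t ^ (d - 1)) * G (\<lambda>i\<in>{1..d}. t * (z(1 := 1)) i) \<partial>lborel_PiM {2..d})"
        by (rule nn_integral_cmult[OF m', symmetric])
      also have "\<dots> = (\<integral>\<^sup>+z. g (z(1 := 1)) * (indicator {0<..} t * indicator {..<1} (t * S z)) \<partial>lborel_PiM {2..d})"
        unfolding G_def sum_eq mult.assoc[symmetric] hom[OF True] using True
        by (simp del: fun_upd_apply)
      finally show ?thesis .
    next
      case False
      have "G (z(1 := t)) = 0" for z
        using supp[of "z(1 := t)"] False by (auto simp: G_def)
      with False show ?thesis by simp
    qed
  qed
  also have "\<dots> = (\<integral>\<^sup>+z. \<integral>\<^sup>+t. g (z(1 := 1)) * (indicator {0<..} t * indicator {..<1} (t * S z))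
      \<partial>lborel \<partial>lborel_PiM {2..d})"
  proof (rule PB.Fubini')
    show "(\<lambda>(z, t). g (z(1 := 1)) * (indicator {0<..} t * indicator {..<1} (t * S z)))
        \<in> borel_measurable (lborel_PiM {2..d} \<Otimes>\<^sub>M lborel)"
      unfolding S_eq using g1 by measurable
  qed
  also have "\<dots> = (\<integral>\<^sup>+z. g (z(1 := 1)) / ennreal (\<Sum>i=1..d. (z(1 := 1)) i) \<partial>lborel_PiM {2..d})"
  proof (rule nn_integral_cong)
    fix z :: "nat \<Rightarrow> real"
    show "(\<integral>\<^sup>+t. g (z(1 := 1)) * (indicator {0<..} t * indicator {..<1} (t * S z)) \<partial>lborel) =
        g (z(1 := 1)) / ennreal (\<Sum>i=1..d. (z(1 := 1)) i)"
    \<comment> \<open>Where \<open>g\<close> is nonzero, \<open>t\<close> runs through an interval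
      of length \<open>1 / S z\<close>. Where \<open>g\<close> vanishes, \<open>S z\<close> may fail
      to be positive, but both sides are 0 because \<open>0 / x = 0\<close> in
      \<open>ennreal\<close> for every \<open>x\<close>.\<close>
    proof (cases "g (z(1 := 1)) = 0")
      case False
      then have S: "S z > 0"
        unfolding S_def using supp by blast
      then have ind: "indicator {0<..} t * indicator {..<1} (t * S z) =
          (indicator {0<..<1 / S z} t :: ennreal)" for t
        by (auto simp: indicator_def field_simps)
      have "(\<integral>\<^sup>+t. g (z(1 := 1)) * indicator {0<..<1 / S z} t \<partial>lborel) =
          g (z(1 := 1)) * ennreal (1 / S z)"
        using S by (subst nn_integral_cmult_indicator) auto
      also have "\<dots> = g (z(1 := 1)) / ennreal (S z)"
        using S by (simp add: divide_ennreal_def inverse_ennreal inverse_eq_divide)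
      finally show ?thesis
        unfolding ind by (simp only: S_def)
    qed simp
  qed
  finally show ?thesis
    using left by simp
qed

section \<open>The ordered cone and homogeneity of the weight\<close>

text \<open>Neither extensionality nor coordinate sum 1 is demanded, so the set is stable under
  positive scaling and can be tested on points of different dimension; adding these two conditions
  gives \<open>ordered_simplex\<close>.\<close>

definition ordered_cone :: "nat \<Rightarrow> (nat \<Rightarrow> real) set" where
  "ordered_cone d = {y. (\<forall>k\<in>{1..<d}. y (Suc k) \<le> y k) \<and> 0 \<le> y d}"

lemma ordered_cone_antimono:
  assumes "y \<in> ordered_cone d" "1 \<le> j" "j \<le> k" "k \<le> d"
  shows "y k \<le> y j"
  using assms(3,4)
proof (induction k rule: dec_induct)
  case (step n)
  then have "y (Suc n) \<le> y n"
    using assms(1,2) by (auto simp: ordered_cone_def)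
  with step show ?case by simp
qed simp

lemma ordered_cone_nonneg:
  assumes "y \<in> ordered_cone d" "1 \<le> k" "k \<le> d"
  shows "0 \<le> y k"
  using ordered_cone_antimono[OF assms(1,2,3)] assms(1) by (simp add: ordered_cone_def)

lemma ordered_cone_scale:
  assumes "d \<ge> 1" "c > 0"
  shows "(\<lambda>i\<in>{1..d}. c * y i) \<in> ordered_cone d \<longleftrightarrow> y \<in> ordered_cone d"
proof -
  let ?z = "\<lambda>i\<in>{1..d}. c * y i"
  have "(\<forall>k\<in>{1..<d}. ?z (Suc k) \<le> ?z k) \<longleftrightarrow> (\<forall>k\<in>{1..<d}. y (Suc k) \<le> y k)"
    using assms(2) by (intro ball_cong) auto
  moreover have "0 \<le> ?z d \<longleftrightarrow> 0 \<le> y d"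
    using assms by (simp add: zero_le_mult_iff)
  ultimately show ?thesis
    by (simp only: ordered_cone_def mem_Collect_eq)
qed

lemma measurable_indicator_ordered_cone:
  assumes "d \<ge> 1"
  shows "(indicator (ordered_cone d) :: _ \<Rightarrow> ennreal) \<in> borel_measurable (lborel_PiM {1..d})"
proof -
  have "{y \<in> space (lborel_PiM {1..d}). (\<forall>k\<in>{1..<d}. y (Suc k) \<le> y k) \<and> 0 \<le> y d}
      \<in> sets (lborel_PiM {1..d})"
    using assms
    by (intro sets.sets_Collect sets.sets_Collect_finite_All borel_measurable_le
        borel_measurable_const measurable_lborel_PiM_component) auto
  also have "{y \<in> space (lborel_PiM {1..d}). (\<forall>k\<in>{1..<d}. y (Suc k) \<le> y k) \<and> 0 \<le> y d} =
      ordered_cone d \<inter> space (lborel_PiM {1..d})"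
    by (auto simp: ordered_cone_def)
  finally show ?thesis
    by (simp only: borel_measurable_indicator_iff)
qed

lemma measurable_GRD_weight:
  "GRD_weight d a \<in> borel_measurable (lborel_PiM {1..d})"
  unfolding GRD_weight_def
  by (intro borel_measurable_prod powr_real_measurable borel_measurable_const
      measurable_lborel_PiM_component)

lemma measurable_GRD_weight_ordered_cone:
  assumes "d \<ge> 1"
  shows "(\<lambda>y. ennreal (GRD_weight d a y) * indicator (ordered_cone d) y)
    \<in> borel_measurable (lborel_PiM {1..d})"
  by (intro borel_measurable_times_ennreal measurable_indicator_ordered_cone assms
      measurable_compose[OF measurable_GRD_weight measurable_ennreal])

lemma GRD_weight_nonneg: "0 \<le> GRD_weight d a y"
  by (simp add: GRD_weight_def prod_nonneg)

text \<open>This turns a first moment into a total mass with one exponent raised. At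
  \<open>y k = 0\<close> both sides vanish because \<open>0 powr s = 0\<close>.\<close>

lemma GRD_weight_mult_component:
  assumes "k \<in> {1..d}" "0 \<le> y k"
  shows "GRD_weight d a y * y k = GRD_weight d (a(k := a k + 1)) y"
proof -
  have "y k powr (a k - 1) * y k = y k powr (a k + 1 - 1)"
    using assms(2) powr_add[of "y k" "a k - 1" 1] by simp
  then show ?thesis
    using assms(1) unfolding GRD_weight_def
    by (simp add: prod.remove[where x = k] mult_ac)
qed

text \<open>The exponents \<open>a k - 1\<close> add up to \<open>tail_sum d a 1 - d\<close>, which
  is therefore the degree of homogeneity.\<close>

lemma GRD_weight_scale:
  assumes "c > 0" "\<And>k. k \<in> {1..d} \<Longrightarrow> 0 \<le> y k"
  shows "GRD_weight d a (\<lambda>i\<in>{1..d}. c * y i) = c powr (tail_sum d a 1 - d) * GRD_weight d a y"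
proof -
  have "GRD_weight d a (\<lambda>i\<in>{1..d}. c * y i) = (\<Prod>k=1..d. c powr (a k - 1)) * GRD_weight d a y"
    unfolding GRD_weight_def prod.distrib[symmetric]
    using assms by (intro prod.cong) (auto simp: powr_mult)
  also have "(\<Prod>k=1..d. c powr (a k - 1)) = c powr (tail_sum d a 1 - d)"
    using assms(1) by (simp add: powr_sum[symmetric] tail_sum_def sum_subtractf)
  finally show ?thesis .
qed

section \<open>Successive integration over the slice of the cone\<close>

lemma nn_integral_powr_from_0:
  fixes b c :: real
  assumes "b > 0" "c \<ge> 0"
  shows "(\<integral>\<^sup>+t. ennreal (t powr (b - 1)) * indicator {0..c} t \<partial>lborel) = ennreal (c powr b / b)"
proof -
  have "((\<lambda>t. t powr (b - 1)) has_integral (c powr b / b)) {0..c}"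
    using has_integral_powr_from_0[of "b - 1" c] assms by simp
  moreover have ind: "(\<lambda>t. t powr (b - 1) * indicator {0..c} t) =
      (\<lambda>t. if t \<in> {0..c} then t powr (b - 1) else 0)"
    by (auto simp: indicator_def)
  ultimately have "((\<lambda>t. t powr (b - 1) * indicator {0..c} t) has_integral (c powr b / b)) UNIV"
    by (simp only: ind has_integral_restrict_UNIV)
  from nn_integral_has_integral_lborel[OF _ _ this]
  have "(\<integral>\<^sup>+t. ennreal (t powr (b - 1) * indicator {0..c} t) \<partial>lborel) = ennreal (c powr b / b)"
    by simp
  then show ?thesis
    by (simp add: ennreal_mult'' ennreal_indicator)
qed

text \<open>Induction on the dimension: integrating the smallest coordinate over
  \<open>{0..y m}\<close> gives \<open>y m powr b (Suc m) / b (Suc m)\<close>, whose denominator is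
  the last tail sum. Its positivity makes the singularity at 0 integrable. For \<open>m = 1\<close>
  the slice is a single point of weight 1.\<close>

lemma nn_integral_GRD_weight_ordered_cone:
  assumes "m \<ge> 1" "\<And>j. j \<in> {2..m} \<Longrightarrow> tail_sum m b j > 0"
  shows "(\<integral>\<^sup>+z. ennreal (GRD_weight m b (z(1 := 1))) * indicator (ordered_cone m) (z(1 := 1))
      \<partial>lborel_PiM {2..m}) = ennreal (\<Prod>j=2..m. 1 / tail_sum m b j)"
  using assms
proof (induction m arbitrary: b rule: dec_induct)
  case base
  then show ?case
    by (simp add: PiM_empty nn_integral_count_space_finite GRD_weight_def ordered_cone_def)
next
  case (step m)
  \<comment> \<open>The power of \<open>y m\<close> left by the innermost integral is absorbed into
    coordinate \<open>m\<close>. Merging the last two exponents leaves every tail sum up to index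
    \<open>m\<close> unchanged.\<close>
  define b' where "b' = b(m := b m + b (Suc m))"
  define I where "I = (\<lambda>n b y. ennreal (GRD_weight n b y) * indicator (ordered_cone n) y)"
  have pos: "b (Suc m) > 0"
    using step.prems[of "Suc m"] step.hyps by (simp add: tail_sum_def)
  have tail: "tail_sum (Suc m) b j = tail_sum m b' j" if "j \<le> m" for j
  proof -
    have "{j..m} = insert m {j..<m}" "{j..Suc m} = insert (Suc m) (insert m {j..<m})"
      using that by auto
    then show ?thesis by (simp add: tail_sum_def b'_def)
  qed
  have split: "insert (Suc m) {2..m} = {2..Suc m}"
    using step.hyps by auto
  have "(\<lambda>z. z(1 := 1)) \<in> measurable (lborel_PiM {2..Suc m}) (lborel_PiM {1..Suc m})"
    by (rule measurable_fun_upd[where J = "{2..Suc m}"]) auto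
  then have meas: "(\<lambda>z. I (Suc m) b (z(1 := 1))) \<in> borel_measurable (lborel_PiM {2..Suc m})"
    unfolding I_def by (rule measurable_compose[OF _ measurable_GRD_weight_ordered_cone]) simp
  have inner: "(\<integral>\<^sup>+t. I (Suc m) b (y(Suc m := t)) \<partial>lborel) = I m b' y * ennreal (1 / b (Suc m))" for y
  proof (cases "y \<in> ordered_cone m")
    case True
    then have nn: "0 \<le> y m"
      by (simp add: ordered_cone_def)
    have ind: "y(Suc m := t) \<in> ordered_cone (Suc m) \<longleftrightarrow> t \<in> {0..y m}" for t
      using True step.hyps by (auto simp: ordered_cone_def)
    have w: "GRD_weight (Suc m) b (y(Suc m := t)) = GRD_weight m b y * t powr (b (Suc m) - 1)" for t
      by (simp add: GRD_weight_def)
    have w': "GRD_weight m b y * y m powr b (Suc m) = GRD_weight m b' y"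
    proof -
      have "y m powr (b m - 1) * y m powr b (Suc m) = y m powr (b m + b (Suc m) - 1)"
        by (simp add: powr_add[symmetric] algebra_simps)
      then show ?thesis
        using step.hyps unfolding GRD_weight_def b'_def
        by (simp add: prod.remove[where x = m and A = "{Suc 0..m}"] mult_ac)
    qed
    have "(\<integral>\<^sup>+t. I (Suc m) b (y(Suc m := t)) \<partial>lborel) =
        (\<integral>\<^sup>+t. ennreal (GRD_weight m b y) * (ennreal (t powr (b (Suc m) - 1)) * indicator {0..y m} t) \<partial>lborel)"
      unfolding I_def w
      by (intro nn_integral_cong) (simp add: ind indicator_def ennreal_mult' GRD_weight_nonneg)
    also have "\<dots> = ennreal (GRD_weight m b y) * ennreal (y m powr b (Suc m) / b (Suc m))"
      by (simp add: nn_integral_cmult nn_integral_powr_from_0[OF pos nn])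
    also have "\<dots> = ennreal (GRD_weight m b' y) * ennreal (1 / b (Suc m))"
      using pos by (simp add: ennreal_mult'[symmetric] GRD_weight_nonneg w'[symmetric])
    finally show ?thesis
      using True by (simp add: I_def)
  next
    \<comment> \<open>Dropping the last coordinate of a cone point leaves a cone point, since
      \<open>0 \<le> t \<le> y m\<close> supplies the new end condition. Contrapositively, both
      sides vanish here.\<close>
    case False
    have "y \<in> ordered_cone m" if c: "y(Suc m := t) \<in> ordered_cone (Suc m)" for t
    proof -
      from c have t: "0 \<le> t"
        and mono: "\<And>k. k \<in> {1..m} \<Longrightarrow> (y(Suc m := t)) (Suc k) \<le> (y(Suc m := t)) k"
        by (auto simp: ordered_cone_def)
      have "y (Suc k) \<le> y k" if "k \<in> {1..<m}" for k
        using mono[of k] that by simp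
      moreover have "t \<le> y m"
        using mono[of m] step.hyps by simp
      ultimately show ?thesis
        using t by (simp add: ordered_cone_def)
    qed
    then have "y(Suc m := t) \<notin> ordered_cone (Suc m)" for t
      using False by blast
    with False show ?thesis by (simp add: I_def)
  qed
  have "(\<integral>\<^sup>+z. I (Suc m) b (z(1 := 1)) \<partial>lborel_PiM {2..Suc m}) =
      (\<integral>\<^sup>+z. \<integral>\<^sup>+t. I (Suc m) b (z(Suc m := t, 1 := 1)) \<partial>lborel \<partial>lborel_PiM {2..m})"
    using lborel_PiM.product_nn_integral_insert[of "{2..m}" "Suc m" "\<lambda>z. I (Suc m) b (z(1 := 1))"] meas
    by (simp only: split) simp
  also have "\<dots> = (\<integral>\<^sup>+z. I m b' (z(1 := 1)) * ennreal (1 / b (Suc m)) \<partial>lborel_PiM {2..m})"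
  proof (rule nn_integral_cong)
    fix z :: "nat \<Rightarrow> real"
    have "z(Suc m := t, 1 := 1) = z(1 := 1, Suc m := t)" for t
      using step.hyps by (simp add: fun_upd_twist)
    then show "(\<integral>\<^sup>+t. I (Suc m) b (z(Suc m := t, 1 := 1)) \<partial>lborel) =
        I m b' (z(1 := 1)) * ennreal (1 / b (Suc m))"
      by (simp only: inner)
  qed
  also have "\<dots> = (\<integral>\<^sup>+z. I m b' (z(1 := 1)) \<partial>lborel_PiM {2..m}) * ennreal (1 / b (Suc m))"
  proof (rule nn_integral_multc)
    have "(\<lambda>z. z(1 := 1)) \<in> measurable (lborel_PiM {2..m}) (lborel_PiM {1..m})"
      by (rule measurable_fun_upd[where J = "{2..m}"]) (use step.hyps in auto)
    then show "(\<lambda>z. I m b' (z(1 := 1))) \<in> borel_measurable (lborel_PiM {2..m})"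
      unfolding I_def
      by (rule measurable_compose[OF _ measurable_GRD_weight_ordered_cone[OF step.hyps(1)]])
  qed
  also have "(\<integral>\<^sup>+z. I m b' (z(1 := 1)) \<partial>lborel_PiM {2..m}) = ennreal (\<Prod>j=2..m. 1 / tail_sum m b' j)"
    unfolding I_def by (rule step.IH) (use step.prems tail in force)
  also have "\<dots> * ennreal (1 / b (Suc m)) = ennreal (\<Prod>j=2..Suc m. 1 / tail_sum (Suc m) b j)"
  proof -
    have "(\<Prod>j=2..m. 1 / tail_sum m b' j) = (\<Prod>j=2..m. 1 / tail_sum (Suc m) b j)"
      using tail by (intro prod.cong) auto
    moreover have "tail_sum (Suc m) b (Suc m) = b (Suc m)"
      by (simp add: tail_sum_def)
    ultimately show ?thesis
      using pos step.hyps by (simp add: ennreal_mult''[symmetric])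
  qed
  finally show ?case
    by (simp only: I_def)
qed

section \<open>First moments over the simplex\<close>

text \<open>Embedded points are extensional with coordinate sum 1 by construction, so only the cone
  conditions remain of membership in the simplex.\<close>

lemma nn_integral_simplex_measure:
  assumes d: "d \<ge> 1" and f: "f \<in> borel_measurable (lborel_PiM {1..d})"
  shows "(\<integral>\<^sup>+y. f y \<partial>simplex_measure d) =
    (\<integral>\<^sup>+x. f (simplex_embed d x) * indicator (ordered_cone d) (simplex_embed d x) \<partial>lborel_PiM {1..<d})"
proof -
  have f': "f \<in> borel_measurable (Pi\<^sub>M {1..d} (\<lambda>_. borel))"
    using f by (simp cong: measurable_cong_sets add: sets_lborel_PiM)
  have "(\<integral>\<^sup>+y. f y \<partial>simplex_measure d) = (\<integral>\<^sup>+x. f (simplex_embed d x) *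
      indicator (ordered_simplex d) (simplex_embed d x) \<partial>lborel_PiM {1..<d})"
    unfolding simplex_measure_def
  proof (subst nn_integral_restrict_space)
    have "(\<lambda>y. f y * indicator (ordered_simplex d) y) \<in> borel_measurable (Pi\<^sub>M {1..d} (\<lambda>_. borel))"
      by (intro borel_measurable_times_ennreal f' borel_measurable_indicator sets_ordered_simplex d)
    then show "(\<integral>\<^sup>+y. f y * indicator (ordered_simplex d) y
          \<partial>distr (lborel_PiM {1..<d}) (Pi\<^sub>M {1..d} (\<lambda>_. borel)) (simplex_embed d)) =
        (\<integral>\<^sup>+x. f (simplex_embed d x) * indicator (ordered_simplex d) (simplex_embed d x)
          \<partial>lborel_PiM {1..<d})"
      by (intro nn_integral_distr measurable_simplex_embed d) (simp only: measurable_distr_eq1)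
  qed (use sets_ordered_simplex[OF d] in \<open>simp add: space_PiM\<close>)
  also have "\<dots> = (\<integral>\<^sup>+x. f (simplex_embed d x) *
      indicator (ordered_cone d) (simplex_embed d x) \<partial>lborel_PiM {1..<d})"
  proof (rule nn_integral_cong)
    fix x assume x: "x \<in> space (lborel_PiM {1..<d})"
    have eq: "{1..d} = insert d {1..<d}"
      using d by auto
    have "simplex_embed d x \<in> {1..d} \<rightarrow>\<^sub>E UNIV"
      using x unfolding eq by (auto simp: simplex_embed_def space_PiM PiE_def extensional_def)
    moreover have "(\<Sum>k=1..d. simplex_embed d x k) = 1"
      unfolding eq by (simp add: simplex_embed_def)
    ultimately have "simplex_embed d x \<in> ordered_simplex d \<longleftrightarrow> simplex_embed d x \<in> ordered_cone d"
      by (simp add: ordered_simplex_def ordered_cone_def)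
    then show "f (simplex_embed d x) * indicator (ordered_simplex d) (simplex_embed d x) =
        f (simplex_embed d x) * indicator (ordered_cone d) (simplex_embed d x)"
      by (simp add: indicator_def)
  qed
  finally show ?thesis .
qed

text \<open>The hypothesis \<open>tail_1\<close> fixes the degree of homogeneity that permits moving
  the integral to the slice. There the factor \<open>y k\<close> raises \<open>a k\<close> by one,
  which adds 1 to exactly the tail sums with \<open>j \<le> k\<close>.\<close>

lemma nn_integral_GRD_weight_component:
  assumes d: "d \<ge> 1" and k: "k \<in> {1..d}" and tail_1: "tail_sum d a 1 = -1"
    and tail_pos: "\<And>j. j \<in> {2..d} \<Longrightarrow> tail_sum d a j > 0"
  shows "(\<integral>\<^sup>+y. ennreal (GRD_weight d a y * y k) \<partial>simplex_measure d) =
    ennreal (\<Prod>j=2..d. 1 / (tail_sum d a j + (if j \<le> k then 1 else 0)))"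
proof -
  \<comment> \<open>The coordinate sum equals 1 on the simplex. Including it brings the degree from
    \<open>-1 - d\<close> for the weight to \<open>1 - d\<close>, as \<open>hom\<close> requires,
    and it cancels the division in the slice formula.\<close>
  define p where "p = (\<lambda>y. GRD_weight d a y * y k * (\<Sum>i=1..d. y i))"
  define g where "g = (\<lambda>y. ennreal (p y) * indicator (ordered_cone d) y)"
  define b where "b = a(k := a k + 1)"
  have g: "g \<in> borel_measurable (lborel_PiM {1..d})"
    unfolding g_def p_def
    using k by (intro borel_measurable_times_ennreal measurable_indicator_ordered_cone d
        measurable_compose[OF _ measurable_ennreal] borel_measurable_times measurable_GRD_weight
        borel_measurable_sum measurable_lborel_PiM_component)
  have f: "(\<lambda>y. ennreal (GRD_weight d a y * y k)) \<in> borel_measurable (lborel_PiM {1..d})"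
    using k by (intro measurable_compose[OF _ measurable_ennreal] borel_measurable_times
        measurable_GRD_weight measurable_lborel_PiM_component)
  have hom: "ennreal (c ^ (d - 1)) * g (\<lambda>i\<in>{1..d}. c * y i) = g y" if c: "c > 0" for c y
  proof (cases "y \<in> ordered_cone d")
    case True
    have W: "GRD_weight d a (\<lambda>i\<in>{1..d}. c * y i) = c powr (- 1 - real d) * GRD_weight d a y"
      using GRD_weight_scale[OF c, of d y a] ordered_cone_nonneg[OF True] tail_1 by simp
    have "c ^ (d - 1) * c powr (- 1 - real d) = c powr (real d - 1) * c powr (- 1 - real d)"
      using c d by (simp add: powr_realpow[symmetric])
    also have "\<dots> = inverse (c * c)"
      using c by (simp add: powr_add[symmetric] powr_minus power2_eq_square)
    finally have P: "c ^ (d - 1) * c powr (- 1 - real d) * c * c = 1"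
      using c by (simp add: field_simps)
    have "p (\<lambda>i\<in>{1..d}. c * y i) =
        c powr (- 1 - real d) * GRD_weight d a y * (c * y k) * (c * (\<Sum>i=1..d. y i))"
      unfolding p_def W using k by (simp add: sum_distrib_left)
    then have "c ^ (d - 1) * p (\<lambda>i\<in>{1..d}. c * y i) =
        (c ^ (d - 1) * c powr (- 1 - real d) * c * c) * p y"
      by (simp only: p_def mult_ac)
    then have "c ^ (d - 1) * p (\<lambda>i\<in>{1..d}. c * y i) = p y"
      by (simp only: P mult_1_left)
    then show ?thesis
      unfolding g_def using True c ordered_cone_scale[OF d c, of y]
      by (simp add: ennreal_mult'[symmetric])
  next
    case False
    then show ?thesis
      using ordered_cone_scale[OF d c, of y] by (simp add: g_def)
  qed
  have supp: "y 1 > 0 \<and> (\<Sum>i=1..d. y i) > 0" if "g y \<noteq> 0" for y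
  proof -
    have y: "y \<in> ordered_cone d" and nz: "y k \<noteq> 0"
      using that by (auto simp: g_def p_def indicator_def split: if_splits)
    then have "y k > 0"
      using ordered_cone_nonneg[OF y, of k] k by simp
    moreover have "y k \<le> y 1"
      using ordered_cone_antimono[OF y] k by simp
    moreover have "y k \<le> (\<Sum>i=1..d. y i)"
      using ordered_cone_nonneg[OF y] k by (intro member_le_sum) auto
    ultimately show ?thesis by simp
  qed
  have "(\<integral>\<^sup>+y. ennreal (GRD_weight d a y * y k) \<partial>simplex_measure d) =
      (\<integral>\<^sup>+x. g (simplex_embed d x) \<partial>lborel_PiM {1..<d})"
  proof -
    have "(\<Sum>i=1..d. simplex_embed d x i) = 1" for x
    proof -
      have "{1..d} = insert d {1..<d}"
        using d by auto
      then show ?thesis by (simp add: simplex_embed_def)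
    qed
    then show ?thesis
      by (simp add: nn_integral_simplex_measure[OF d f] g_def p_def)
  qed
  also have "\<dots> = (\<integral>\<^sup>+z. g (z(1 := 1)) / ennreal (\<Sum>i=1..d. (z(1 := 1)) i) \<partial>lborel_PiM {2..d})"
    by (rule nn_integral_simplex_embed_homogeneous[OF d g hom supp])
  \<comment> \<open>On the cone the coordinate sum is at least the first coordinate, here 1, so the
    division is by a positive number and removes the extra factor of \<open>p\<close>.\<close>
  also have "\<dots> = (\<integral>\<^sup>+z. ennreal (GRD_weight d b (z(1 := 1))) * indicator (ordered_cone d) (z(1 := 1))
      \<partial>lborel_PiM {2..d})"
  proof (rule nn_integral_cong)
    fix z :: "nat \<Rightarrow> real"
    define y where "y = z(1 := 1)"
    have "g y / ennreal (\<Sum>i=1..d. y i) = ennreal (GRD_weight d b y) * indicator (ordered_cone d) y"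
    proof (cases "y \<in> ordered_cone d")
      case True
      have "y 1 \<le> (\<Sum>i=1..d. y i)"
        using ordered_cone_nonneg[OF True] d by (intro member_le_sum) auto
      then have "(\<Sum>i=1..d. y i) > 0"
        by (simp add: y_def)
      then show ?thesis
        using True k ordered_cone_nonneg[OF True, of k]
        by (simp add: g_def p_def b_def GRD_weight_mult_component divide_ennreal GRD_weight_nonneg)
    qed (simp add: g_def)
    then show "g (z(1 := 1)) / ennreal (\<Sum>i=1..d. (z(1 := 1)) i) =
        ennreal (GRD_weight d b (z(1 := 1))) * indicator (ordered_cone d) (z(1 := 1))"
      by (simp only: y_def)
  qed
  also have "\<dots> = ennreal (\<Prod>j=2..d. 1 / tail_sum d b j)"
  proof (rule nn_integral_GRD_weight_ordered_cone[OF d])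
    show "tail_sum d b j > 0" if "j \<in> {2..d}" for j
    proof -
      have "tail_sum d a j \<le> tail_sum d b j"
        unfolding tail_sum_def b_def by (intro sum_mono) auto
      with tail_pos[OF that] show ?thesis by simp
    qed
  qed
  also have "(\<Prod>j=2..d. 1 / tail_sum d b j) =
      (\<Prod>j=2..d. 1 / (tail_sum d a j + (if j \<le> k then 1 else 0)))"
  proof -
    have "tail_sum d b j = tail_sum d a j + (if j \<le> k then 1 else 0)" for j
    proof -
      have "tail_sum d b j = (\<Sum>i=j..d. a i + (if i = k then 1 else 0))"
        unfolding tail_sum_def b_def by (intro sum.cong) auto
      then show ?thesis
        using k by (simp add: tail_sum_def sum.distrib)
    qed
    then show ?thesis by simp
  qed
  finally show ?thesis .
qed

section \<open>From unnormalized moments to expectations\<close>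

lemma measurable_simplex_measure:
  "f \<in> borel_measurable (lborel_PiM {1..d}) \<Longrightarrow> f \<in> borel_measurable (simplex_measure d)"
  unfolding simplex_measure_def
  by (rule measurable_restrict_space1) (simp cong: measurable_cong_sets add: sets_lborel_PiM)

lemma space_simplex_measure: "space (simplex_measure d) \<subseteq> ordered_simplex d"
  by (simp add: simplex_measure_def space_restrict_space)

text \<open>Knowing the moments up to a common factor \<open>C\<close> is enough: coordinates sum to
  1 on the simplex, so adding the moments identifies the normalizing constant as \<open>C\<close>,
  which is then positive and finite.\<close>

lemma integral_GRD_component:
  assumes d: "d \<ge> 1" and k: "k \<in> {1..d}" and "C > 0"
    and moment: "\<And>j. j \<in> {1..d} \<Longrightarrow>
      (\<integral>\<^sup>+y. ennreal (GRD_weight d a y * y j) \<partial>simplex_measure d) = ennreal (C * v j)"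
    and v: "\<And>j. j \<in> {1..d} \<Longrightarrow> v j \<ge> 0" "(\<Sum>j=1..d. v j) = 1"
  shows "integral\<^sup>L (GRD d a) (\<lambda>y. y k) = v k"
proof -
  have nonneg: "0 \<le> y j" if "y \<in> space (simplex_measure d)" "j \<in> {1..d}" for y j
    using that space_simplex_measure[of d] ordered_cone_nonneg[of y d j]
    by (auto simp: ordered_simplex_def ordered_cone_def)
  have w: "GRD_weight d a \<in> borel_measurable (simplex_measure d)"
    by (intro measurable_simplex_measure measurable_GRD_weight)
  have c: "(\<lambda>y. y j) \<in> borel_measurable (simplex_measure d)" if "j \<in> {1..d}" for j
    using that by (intro measurable_simplex_measure measurable_lborel_PiM_component)
  have m: "(\<lambda>y. ennreal (GRD_weight d a y * y j)) \<in> borel_measurable (simplex_measure d)"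
    if "j \<in> {1..d}" for j
    by (intro measurable_compose[OF _ measurable_ennreal] borel_measurable_times w c that)
  have "GRD_const d a = (\<integral>\<^sup>+y. (\<Sum>j=1..d. ennreal (GRD_weight d a y * y j)) \<partial>simplex_measure d)"
    unfolding GRD_const_def
  proof (rule nn_integral_cong)
    fix y assume y: "y \<in> space (simplex_measure d)"
    then have "(\<Sum>j=1..d. y j) = 1"
      using space_simplex_measure[of d] by (auto simp: ordered_simplex_def)
    then have "GRD_weight d a y = (\<Sum>j=1..d. GRD_weight d a y * y j)"
      by (simp add: sum_distrib_left[symmetric])
    then show "ennreal (GRD_weight d a y) = (\<Sum>j=1..d. ennreal (GRD_weight d a y * y j))"
      using nonneg[OF y] by (subst sum_ennreal) (auto simp: GRD_weight_nonneg)
  qed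
  also have "\<dots> = (\<Sum>j=1..d. ennreal (C * v j))"
    by (subst nn_integral_sum) (simp_all only: m moment cong: sum.cong)
  also have "\<dots> = ennreal C"
    using v \<open>C > 0\<close> by (subst sum_ennreal) (auto simp: sum_distrib_left[symmetric])
  finally have const: "GRD_const d a = ennreal C" .
  \<comment> \<open>The nonnegative integral computed below is finite, so the result is a genuine
    expectation and not the default value for a non-integrable function.\<close>
  have "integral\<^sup>L (GRD d a) (\<lambda>y. y k) = enn2real (\<integral>\<^sup>+y. ennreal (y k) \<partial>GRD d a)"
  proof (rule integral_eq_nn_integral)
    show "(\<lambda>y. y k) \<in> borel_measurable (GRD d a)"
      unfolding GRD_def measurable_density_eq1 by (rule c[OF k])
    show "AE y in GRD d a. 0 \<le> y k"
    proof (rule AE_I2)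
      fix y assume "y \<in> space (GRD d a)"
      then show "0 \<le> y k"
        using nonneg[of y k] k by (simp add: GRD_def)
    qed
  qed
  also have "(\<integral>\<^sup>+y. ennreal (y k) \<partial>GRD d a) =
      (\<integral>\<^sup>+y. ennreal (GRD_weight d a y) / ennreal C * ennreal (y k) \<partial>simplex_measure d)"
    unfolding GRD_def const divide_ennreal_def
    by (intro nn_integral_density borel_measurable_times_ennreal borel_measurable_const
        measurable_compose[OF w measurable_ennreal] measurable_compose[OF c[OF k] measurable_ennreal])
  also have "\<dots> = (\<integral>\<^sup>+y. ennreal (GRD_weight d a y * y k) / ennreal C \<partial>simplex_measure d)"
    by (intro nn_integral_cong)
       (simp only: divide_ennreal_def ennreal_mult'[OF GRD_weight_nonneg], simp only: mult_ac)
  also have "\<dots> = ennreal (C * v k) / ennreal C"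
    by (subst nn_integral_divide[OF m[OF k]]) (simp only: moment[OF k])
  also have "\<dots> = ennreal (v k)"
    using \<open>C > 0\<close> v(1)[OF k] by (simp add: divide_ennreal)
  finally show ?thesis
    using v(1)[OF k] by simp
qed

section \<open>Tail sums of the prescribed parameter and the conclusion\<close>

text \<open>The entries of \<open>a\<close> are differences chosen so that tail sums telescope to
  \<open>y k / (y (k - 1) - y k)\<close>. Strict ordering keeps the denominators positive, and
  \<open>y d > 0\<close> makes the numerators positive, including the one at
  \<open>k = d\<close>.\<close>

theorem corollary8:
  fixes d :: nat and y a :: "nat \<Rightarrow> real"
  assumes "d \<ge> 2"
    and "y \<in> ordered_simplex d"
    and "\<And>k. 1 \<le> k \<Longrightarrow> k < d \<Longrightarrow> y k > y (k + 1)"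
    and "y d > 0"
    and "a 1 = - 1 - y 2 / (y 1 - y 2)"
    and "\<And>k. 2 \<le> k \<Longrightarrow> k \<le> d - 1 \<Longrightarrow>
           a k = y k / (y (k - 1) - y k) - y (k + 1) / (y k - y (k + 1))"
    and "a d = y d / (y (d - 1) - y d)"
  shows "(\<forall>k\<in>{2..d}. tail_sum d a k > 0)
       \<and> tail_sum d a 1 = - 1
       \<and> (\<forall>k\<in>{1..d}. integral\<^sup>L (GRD d a) (\<lambda>Y. Y k) = y k)"
proof -
  note d = assms(1)
  have cone: "y \<in> ordered_cone d" and sum_y: "(\<Sum>k=1..d. y k) = 1"
    using assms(2) by (auto simp: ordered_simplex_def ordered_cone_def)
  have y_pos: "y k > 0" if "k \<in> {1..d}" for k
    using ordered_cone_antimono[OF cone, of k d] assms(4) that by simp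
  have step: "y k < y (k - 1)" if "k \<in> {2..d}" for k
    using assms(3)[of "k - 1"] that by auto
  have tail_Suc: "tail_sum d a k = a k + tail_sum d a (Suc k)" if "k \<le> d" for k
    using that by (simp add: tail_sum_def sum.atLeast_Suc_atMost)
  \<comment> \<open>Downward induction from \<open>d\<close>: the fraction subtracted in
    \<open>a n\<close> is \<open>tail_sum d a (Suc n)\<close>, so it cancels.\<close>
  have tail: "tail_sum d a k = y k / (y (k - 1) - y k)" if "2 \<le> k" "k \<le> d" for k
    using that(2,1)
  proof (induction k rule: inc_induct)
    case base
    then show ?case using assms(7) by (simp add: tail_sum_def)
  next
    case (step n)
    then show ?case using tail_Suc[of n] assms(6)[of n] by simp
  qed
  have pos: "tail_sum d a k > 0" if "k \<in> {2..d}" for k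
    using that tail[of k] step[OF that] y_pos[of k] by simp
  have tail_1: "tail_sum d a 1 = -1"
    using tail_Suc[of 1] tail[of 2] d assms(5) by (simp add: numeral_2_eq_2)
  \<comment> \<open>\<open>D\<close> is the unnormalized mean of the first coordinate, as no tail
    sum is shifted for \<open>k = 1\<close>. The common factor of all moments is therefore
    \<open>D / y 1\<close>.\<close>
  define D where "D = (\<Prod>j=2..d. 1 / tail_sum d a j)"
  have D: "D > 0"
    unfolding D_def using pos by (intro prod_pos) simp
  have ratio: "(\<Prod>j=2..d. 1 / (tail_sum d a j + (if j \<le> k then 1 else 0))) = D / y 1 * y k"
    if "1 \<le> k" "k \<le> d" for k
  proof -
    have "(\<Prod>j=2..d. 1 / (tail_sum d a j + (if j \<le> k then 1 else 0))) =
        (\<Prod>j=2..d. 1 / tail_sum d a j * (if j \<le> k then y j / y (j - 1) else 1))"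
    proof (rule prod.cong)
      fix j assume j: "j \<in> {2..d}"
      \<comment> \<open>Replacing \<open>1 / tail_sum d a j\<close> by
        \<open>1 / (tail_sum d a j + 1)\<close> thus costs the ratio \<open>y j / y (j - 1)\<close>;
        the ratios for \<open>j\<close> from 2 to \<open>k\<close> telescope to
        \<open>y k / y 1\<close>.\<close>
      then have "tail_sum d a j + 1 = y (j - 1) / (y (j - 1) - y j)"
        using step[OF j] tail[of j] by (simp add: field_simps)
      then show "1 / (tail_sum d a j + (if j \<le> k then 1 else 0)) =
          1 / tail_sum d a j * (if j \<le> k then y j / y (j - 1) else 1)"
        using j y_pos[of j] tail[of j] by simp
    qed simp
    also have "\<dots> = D * (\<Prod>j=2..d. if j \<le> k then y j / y (j - 1) else 1)"
      unfolding D_def by (rule prod.distrib)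
    also have "(\<Prod>j=2..d. if j \<le> k then y j / y (j - 1) else 1) = (\<Prod>j=2..k. y j / y (j - 1))"
      using that by (intro prod.mono_neutral_cong_right) auto
    also have "\<dots> = y k / y 1"
      using that
    proof (induction k rule: dec_induct)
      case base
      then show ?case using y_pos[of 1] d by simp
    next
      case (step n)
      then show ?case using y_pos[of n] by simp
    qed
    finally show ?thesis by simp
  qed
  have "integral\<^sup>L (GRD d a) (\<lambda>Y. Y k) = y k" if k: "k \<in> {1..d}" for k
  proof (rule integral_GRD_component[OF _ k])
    show "D / y 1 > 0"
      using D y_pos[of 1] d by simp
    show "(\<integral>\<^sup>+Y. ennreal (GRD_weight d a Y * Y j) \<partial>simplex_measure d) = ennreal (D / y 1 * y j)"
      if "j \<in> {1..d}" for j
      using nn_integral_GRD_weight_component[OF _ that tail_1 pos] ratio[of j] that d by simp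
  qed (use d sum_y y_pos in \<open>auto intro: less_imp_le\<close>)
  with pos tail_1 show ?thesis by blast
qed

end
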